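(* (i) Let $A:\mathcal F_\lambda\otimes\mathcal F_\gamma\otimes\mathcal F_\tau\to\mathcal F_{\lambda+\gamma+\tau+1}$ be a $\mathfrak{vect}(1)$-invariant ternary differential operator of order $1$. Then, up to permutations and dualizations, $A$ is a multiple of one of the following operators, evaluated on $\varphi(dx)^\lambda\otimes\psi(dx)^\gamma\otimes\chi(dx)^\tau$, where the $\epsilon_i$ are constants: (a) for $(\lambda,\gamma,\tau)=(0,0,0)$: $\ \epsilon_1\, d\varphi\cdot\psi\cdot\chi+\epsilon_2\,\varphi\cdot d\psi\cdot\chi+\epsilon_3\,\varphi\cdot\psi\cdot d\chi$; (b) for $\lambda\neq0$: $\ \epsilon_1\{\varphi(dx)^\lambda,\psi(dx)^\gamma\}\,\chi(dx)^\tau+\epsilon_2\{\varphi(dx)^\lambda,\chi(dx)^\tau\}\,\psi(dx)^\gamma$. (ii) Let $A:\mathcal F_\lambda\otimes\mathcal F_\gamma\otimes\mathcal F_\tau\to\mathcal F_{\lambda+\gamma+\tau+2}$ be a $\mathfrak{vect}(1)$-invariant ternary differential operator of order $2$. Then, up to permutations and dualizations, $A$ is a multiple of one of the following operators, where the $\epsilon_i$ are constants: (a) for $(\gamma,\lambda)=(0,0)$: $\ \epsilon_1\{\varphi,d\psi\}\,\chi(dx)^\tau+\epsilon_2\{\chi(dx)^\tau,d\varphi\}\,\psi+\epsilon_3\{d\psi,\chi(dx)^\tau\}\,\varphi$; (b) otherwise: $\ \epsilon_1\{\{\varphi(dx)^\lambda,\psi(dx)^\gamma\},\chi(dx)^\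tau\}+\epsilon_2\{\{\varphi(dx)^\lambda,\chi(dx)^\tau\},\psi(dx)^\gamma\}$.
   Context: For $\lambda\in\mathbb R$, $\mathcal F_\lambda=\{f(dx)^\lambda : f\in\mathbb R[x]\}$ is the space of weighted densities of weight $\lambda$ on $\mathbb R$. The Lie algebra $\mathfrak{vect}(1)$ of polynomial vector fields $X=h\frac{d}{dx}$, $h\in\mathbb R[x]$, acts on $\mathcal F_\lambda$ by $L_X(f(dx)^\lambda)=(hf'+\lambda h'f)(dx)^\lambda$. Densities are multiplied by $f(dx)^\lambda\cdot g(dx)^\mu=fg(dx)^{\lambda+\mu}$, and $\mathcal F_0$ is the space of functions. A ternary differential operator $A:\mathcal F_\lambda\otimes\mathcal F_\gamma\otimes\mathcal F_\tau\to\mathcal F_\mu$ is $\mathfrak{vect}(1)$-invariant if $L_X A(a,b,c)=A(L_Xa,b,c)+A(a,L_Xb,c)+A(a,b,L_Xc)$ for all $X\in\mathfrak{vect}(1)$. An invariant operator of order $k$ has the form $\varphi(dx)^\lambda\otimes\psi(dx)^\gamma\otimes\chi(dx)^\tau\mapsto\sum_{i+j+l=k}\alpha_{i,j,l}\varphi^{(i)}\psi^{(j)}\chi^{(l)}(dx)^\mu$ with constants $\alpha_{i,j,l}\in\mathbb R$ and $\mu=\lambda+\gamma+\tau+k$. De Rham differential: $d:\mathcal F_0\to\mathcal F_1$, $d\varphi=\varphi'dx$. Poisson bracket: $\{\varphi(dx)^\lambda,\psi(dx)^\mu\}=(-\lambda\varphi\psi'+\mu\varphi'\psi)(dx)^{\lambda+\mu+1}$.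 Dualizations: for $A=\sum\alpha_{i,j,l}\varphi^{(i)}\psi^{(j)}\chi^{(l)}$ from $\mathcal F_\lambda\otimes\mathcal F_\gamma\otimes\mathcal F_\tau$ to $\mathcal F_\mu$, the three dualizations are the formal adjoints (via integration by parts, $(\mathcal F_\alpha)^*:=\mathcal F_{1-\alpha}$) in each argument. $A^{*1}:\mathcal F_{1-\mu}\otimes\mathcal F_\gamma\otimes\mathcal F_\tau\to\mathcal F_{1-\lambda}$ is $(\omega,\psi,\chi)\mapsto\sum\alpha_{i,j,l}(-1)^i(\omega\psi^{(j)}\chi^{(l)})^{(i)}$; $A^{*2}:\mathcal F_\lambda\otimes\mathcal F_{1-\mu}\otimes\mathcal F_\tau\to\mathcal F_{1-\gamma}$ and $A^{*3}:\mathcal F_\lambda\otimes\mathcal F_\gamma\otimes\mathcal F_{1-\mu}\to\mathcal F_{1-\tau}$ are defined analogously. Permutations: for $\sigma\in S_3$, $A^\sigma(a,b,c)=A(\sigma^{-1}(a,b,c))$, with the weights permuted accordingly. "Up to permutations and dualizations" means after applying finitely many of these operations. *)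

theory Defs
  imports "HOL-Computational_Algebra.Polynomial" "HOL-Combinatorics.Permutations"
begin

text \<open>
  The density \<open>f (dx)\<^sup>w\<close> of weight \<open>w\<close> is represented by its coefficient \<open>f :: real poly\<close>; the
  weight is passed separately wherever an operation depends on it. The product of densities is
  then the product of polynomials, the weights being added.
\<close>

text \<open>The action of \<open>h d/dx\<close> on densities of weight \<open>w\<close>.\<close>

definition lie_deriv :: "real \<Rightarrow> real poly \<Rightarrow> real poly \<Rightarrow> real poly" where
  "lie_deriv w h f = h * pderiv f + smult w (pderiv h * f)"

text \<open>Used on functions (weight 0) only; the result has weight 1.\<close>

definition de_Rham :: "real poly \<Rightarrow> real poly" where
  "de_Rham f = pderiv f"

text \<open>The bracket of \<open>f (dx)\<^sup>v\<close> and \<open>g (dx)\<^sup>w\<close>; the result has weight \<open>v + w + 1\<close>.\<close>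

definition poisson :: "real \<Rightarrow> real \<Rightarrow> real poly \<Rightarrow> real poly \<Rightarrow> real poly" where
  "poisson v w f g = smult (- v) (f * pderiv g) + smult w (pderiv f * g)"

type_synonym tern_op = "real poly \<times> real poly \<times> real poly \<Rightarrow> real poly"

text \<open>
  The ternary differential operator of order at most \<open>k\<close> with coefficients \<open>c\<close>. The coefficients
  may be arbitrary polynomials; that they are constant, and vanish for \<open>i + j + l < k\<close>, is a
  consequence of invariance when the target weight is the sum of the source weights plus \<open>k\<close>.
\<close>

definition tern_diffop :: "nat \<Rightarrow> (nat \<Rightarrow> nat \<Rightarrow> nat \<Rightarrow> real poly) \<Rightarrow> tern_op" where
  "tern_diffop k c = (\<lambda>(\<phi>, \<psi>, \<chi>). \<Sum>i\<le>k. \<Sum>j\<le>k - i. \<Sum>l\<le>k - i - j.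
     c i j l * (pderiv ^^ i) \<phi> * (pderiv ^^ j) \<psi> * (pderiv ^^ l) \<chi>)"

definition is_tern_diffop :: "nat \<Rightarrow> tern_op \<Rightarrow> bool" where
  "is_tern_diffop k A \<longleftrightarrow> (\<exists>c. A = tern_diffop k c)"

text \<open>The formal adjoints of \<^term>\<open>tern_diffop k c\<close> in each of the three arguments.\<close>

definition adjoint1 :: "nat \<Rightarrow> (nat \<Rightarrow> nat \<Rightarrow> nat \<Rightarrow> real poly) \<Rightarrow> tern_op" where
  "adjoint1 k c = (\<lambda>(\<omega>, \<psi>, \<chi>). \<Sum>i\<le>k. \<Sum>j\<le>k - i. \<Sum>l\<le>k - i - j.
     (-1) ^ i * (pderiv ^^ i) (c i j l * \<omega> * (pderiv ^^ j) \<psi> * (pderiv ^^ l) \<chi>))"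

definition adjoint2 :: "nat \<Rightarrow> (nat \<Rightarrow> nat \<Rightarrow> nat \<Rightarrow> real poly) \<Rightarrow> tern_op" where
  "adjoint2 k c = (\<lambda>(\<phi>, \<omega>, \<chi>). \<Sum>i\<le>k. \<Sum>j\<le>k - i. \<Sum>l\<le>k - i - j.
     (-1) ^ j * (pderiv ^^ j) (c i j l * (pderiv ^^ i) \<phi> * \<omega> * (pderiv ^^ l) \<chi>))"

definition adjoint3 :: "nat \<Rightarrow> (nat \<Rightarrow> nat \<Rightarrow> nat \<Rightarrow> real poly) \<Rightarrow> tern_op" where
  "adjoint3 k c = (\<lambda>(\<phi>, \<psi>, \<omega>). \<Sum>i\<le>k. \<Sum>j\<le>k - i. \<Sum>l\<le>k - i - j.
     (-1) ^ l * (pderiv ^^ l) (c i j l * (pderiv ^^ i) \<phi> * (pderiv ^^ j) \<psi> * \<omega>))"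

text \<open>
  \<open>((\<kappa>, \<gamma>, \<tau>), \<mu>, A)\<close> stands for \<open>A\<close> regarded as an operator from densities of weights
  \<open>\<kappa>, \<gamma>, \<tau>\<close> to densities of weight \<open>\<mu>\<close>.
\<close>

type_synonym weighted_op = "(real \<times> real \<times> real) \<times> real \<times> tern_op"

definition vect_invariant :: "weighted_op \<Rightarrow> bool" where
  "vect_invariant = (\<lambda>((\<kappa>, \<gamma>, \<tau>), \<mu>, A). \<forall>h \<phi> \<psi> \<chi>.
     lie_deriv \<mu> h (A (\<phi>, \<psi>, \<chi>)) =
       A (lie_deriv \<kappa> h \<phi>, \<psi>, \<chi>) + A (\<phi>, lie_deriv \<gamma> h \<psi>, \<chi>) + A (\<phi>, \<psi>, lie_deriv \<tau> h \<chi>))"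

text \<open>The left action of permutations of the positions 0, 1, 2 on triples.\<close>

definition perm3 :: "(nat \<Rightarrow> nat) \<Rightarrow> 'a \<times> 'a \<times> 'a \<Rightarrow> 'a \<times> 'a \<times> 'a" where
  "perm3 \<sigma> = (\<lambda>(x, y, z). ([x, y, z] ! inv \<sigma> 0, [x, y, z] ! inv \<sigma> 1, [x, y, z] ! inv \<sigma> 2))"

text \<open>
  The second operator is obtained from the first by finitely many permutations and dualizations.
  The dualization rules are unambiguous because an operator determines its coefficients.
\<close>

inductive perm_dual :: "weighted_op \<Rightarrow> weighted_op \<Rightarrow> bool" for X :: weighted_op where
  refl: "perm_dual X X"
| permutation: "perm_dual X (w, \<mu>, A) \<Longrightarrow> \<sigma> permutes {0, 1, 2} \<Longrightarrow>
    perm_dual X (perm3 \<sigma> w, \<mu>, \<lambda>t. A (perm3 (inv \<sigma>) t))"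
| dual1: "perm_dual X ((\<kappa>, \<gamma>, \<tau>), \<mu>, tern_diffop k c) \<Longrightarrow>
    perm_dual X ((1 - \<mu>, \<gamma>, \<tau>), 1 - \<kappa>, adjoint1 k c)"
| dual2: "perm_dual X ((\<kappa>, \<gamma>, \<tau>), \<mu>, tern_diffop k c) \<Longrightarrow>
    perm_dual X ((\<kappa>, 1 - \<mu>, \<tau>), 1 - \<gamma>, adjoint2 k c)"
| dual3: "perm_dual X ((\<kappa>, \<gamma>, \<tau>), \<mu>, tern_diffop k c) \<Longrightarrow>
    perm_dual X ((\<kappa>, \<gamma>, 1 - \<mu>), 1 - \<tau>, adjoint3 k c)"

end

theory Submission imports Defs begin

text \<open>
  Invariance under \<open>d/dx\<close> and \<open>x d/dx\<close> makes the coefficients of an invariant operator of order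
  \<open>k\<close> constant and leaves only those with \<open>i + j + l = k\<close>. The derivatives of densities transform
  like densities up to terms with \<open>h''\<close> and higher derivatives of \<open>h\<close>, and these anomalies have
  to cancel. This is one linear equation
  \<open>a\<kappa> + b\<gamma> + c\<tau> = 0\<close> in order 1, and the four linear equations \<open>anomaly_free2\<close> in order 2.

  In order 1 the three coefficients are free if all weights vanish. Otherwise a permutation brings
  a nonzero weight to the first place; then \<open>b\<close> and \<open>c\<close> determine \<open>a\<close>, and the brackets realize
  every choice of \<open>b\<close> and \<open>c\<close> (\<open>op1_bracket_form\<close>).

  In order 2 it is best to treat the input weights \<open>\<kappa>, \<gamma>, \<tau>\<close> and the weight
  \<open>\<nu> = 1 - \<mu> = - 1 - \<kappa> - \<gamma> - \<tau>\<close> dual to the target on the same footing: permutations and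
  dualizations permute the four of them arbitrarily. If two of the four vanish, they can be brought
  to the first two places, and the solutions of the equations are visibly the three-parameter
  family with de Rham differentials (\<open>op2_bracket_form_two_zeros\<close>). If at most one vanishes, it can
  be moved to the target, so that the three inputs have nonzero weights (\<open>reaches2_arrange\<close>). Then
  a solution is determined by \<open>b\<close> and \<open>c\<close> (\<open>anomaly_free2_unique\<close>), and as the two double brackets
  have \<open>(b, c) = (- \<kappa>\<tau>, 0)\<close> and \<open>(0, - \<kappa>\<gamma>)\<close>, they span all solutions
  (\<open>op2_bracket_form\<close>). So no exceptional weights occur.
\<close>

section \<open>Coefficients of invariant operators\<close>

lemma higher_pderiv_divided_power:
  "(pderiv ^^ n) (monom (1 / fact n) n :: real poly) = 1"
proof (rule poly_eqI)
  fix m show "coeff ((pderiv ^^ n) (monom (1 / fact n) n :: real poly)) m = coeff 1 m"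
    by (cases m) (simp_all add: coeff_higher_pderiv flip: pochhammer_fact)
qed

lemma higher_pderiv_divided_power_eq_0:
  "n < m \<Longrightarrow> (pderiv ^^ m) (monom (1 / fact n) n :: real poly) = 0"
  by (rule poly_eqI) (simp add: coeff_higher_pderiv)

text \<open>
  On the divided powers \<open>x\<^sup>i / i!\<close>, \<open>x\<^sup>j / j!\<close>, \<open>x\<^sup>l / l!\<close> the term of index \<open>(i, j, l)\<close> is the
  coefficient itself, and the other terms that survive have a smaller index sum. So the
  coefficients vanish one after another, by induction on \<open>i + j + l\<close>.
\<close>
lemma tern_diffop_eq_0D:
  assumes zero: "\<And>\<phi> \<psi> \<chi>. tern_diffop k c (\<phi>, \<psi>, \<chi>) = 0" and "i + j + l \<le> k"
  shows "c i j l = 0"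
  using assms(2)
proof (induction "i + j + l" arbitrary: i j l rule: less_induct)
  case less
  define X :: "nat \<Rightarrow> real poly" where "X = (\<lambda>n. monom (1 / fact n) n)"
  define t where "t i' j' l' = c i' j' l' * (pderiv ^^ i') (X i) * (pderiv ^^ j') (X j) * (pderiv ^^ l') (X l)"
    for i' j' l'
  have t0: "t i' j' l' = 0" if "(i', j', l') \<noteq> (i, j, l)" "i' + j' + l' \<le> k" for i' j' l'
  proof (cases "i' \<le> i \<and> j' \<le> j \<and> l' \<le> l")
    case True
    with that(1) have "i' + j' + l' < i + j + l" by auto
    with that(2) show ?thesis by (simp add: t_def less.hyps)
  next
    case False
    then show ?thesis
      by (auto simp: t_def X_def higher_pderiv_divided_power_eq_0 not_le)
  qed
  have "tern_diffop k c (X i, X j, X l) = (\<Sum>i'\<le>k. \<Sum>j'\<le>k - i'. \<Sum>l'\<le>k - i' - j'. t i' j' l')"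
    by (simp add: tern_diffop_def t_def)
  also have "\<dots> = (\<Sum>i'\<le>k. if i' = i then (\<Sum>j'\<le>k - i. \<Sum>l'\<le>k - i - j'. t i j' l') else 0)"
    by (intro sum.cong refl) (auto intro!: sum.neutral t0)
  also have "\<dots> = (\<Sum>j'\<le>k - i. \<Sum>l'\<le>k - i - j'. t i j' l')"
    using less.prems by simp
  also have "\<dots> = (\<Sum>j'\<le>k - i. if j' = j then (\<Sum>l'\<le>k - i - j. t i j l') else 0)"
    using less.prems by (intro sum.cong refl) (auto intro!: sum.neutral t0)
  also have "\<dots> = (\<Sum>l'\<le>k - i - j. t i j l')"
    using less.prems by simp
  also have "\<dots> = (\<Sum>l'\<le>k - i - j. if l' = l then t i j l else 0)"
    using less.prems by (intro sum.cong refl) (auto intro!: t0)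
  also have "\<dots> = t i j l"
    using less.prems by simp
  also have "\<dots> = c i j l"
    by (simp add: t_def X_def higher_pderiv_divided_power)
  finally show ?case by (simp add: zero)
qed

lemma lie_deriv_mult:
  "lie_deriv (u + v) h (f * g) = lie_deriv u h f * g + f * lie_deriv v h g"
  by (simp add: lie_deriv_def pderiv_mult smult_add_left algebra_simps)

lemma lie_deriv_sum: "lie_deriv w h (\<Sum>x\<in>S. f x) = (\<Sum>x\<in>S. lie_deriv w h (f x))"
  by (induction S rule: infinite_finite_induct)
     (simp_all add: lie_deriv_def pderiv_add smult_add_right algebra_simps)

text \<open>
  For affine \<open>h\<close> the derivative is an equivariant map from weight \<open>w\<close> to weight \<open>w + 1\<close>, because
  the obstruction \<open>w h'' f\<close> vanishes.
\<close>
lemma higher_pderiv_lie_deriv_affine: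
  assumes "pderiv (pderiv h) = 0"
  shows "(pderiv ^^ n) (lie_deriv w h f) = lie_deriv (w + real n) h ((pderiv ^^ n) f)"
proof (induction n)
  case (Suc n)
  have "pderiv (lie_deriv v h g) = lie_deriv (v + 1) h (pderiv g)" for v g
    using assms
    by (simp add: lie_deriv_def pderiv_mult pderiv_add pderiv_smult smult_add_left algebra_simps)
  with Suc show ?case by (simp add: add_ac)
qed simp

text \<open>
  Under affine fields the derivatives of the arguments are densities of weights \<open>\<kappa> + i\<close>,
  \<open>\<gamma> + j\<close>, \<open>\<tau> + l\<close>. Compared with the target weight, this makes the coefficient a density of
  weight \<open>k - (i + j + l)\<close>. The failure of invariance is the operator whose coefficients are the
  Lie derivatives of the coefficients, so these are zero.
\<close>
lemma vect_invariant_coeffs: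
  assumes inv: "vect_invariant ((\<kappa>, \<gamma>, \<tau>), \<kappa> + \<gamma> + \<tau> + real k, tern_diffop k c)"
    and le: "i + j + l \<le> k" and h: "pderiv (pderiv h) = 0"
  shows "lie_deriv (real k - real (i + j + l)) h (c i j l) = 0"
proof -
  define e where "e i j l = lie_deriv (real k - real (i + j + l)) h (c i j l)" for i j l
  have "tern_diffop k e (\<phi>, \<psi>, \<chi>) = 0" for \<phi> \<psi> \<chi>
  proof -
    let ?D = "\<lambda>i. pderiv ^^ i"
    have term_eq: "lie_deriv (\<kappa> + \<gamma> + \<tau> + real k) h (c i j l * ?D i \<phi> * ?D j \<psi> * ?D l \<chi>) =
        e i j l * ?D i \<phi> * ?D j \<psi> * ?D l \<chi>
        + c i j l * ?D i (lie_deriv \<kappa> h \<phi>) * ?D j \<psi> * ?D l \<chi>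
        + c i j l * ?D i \<phi> * ?D j (lie_deriv \<gamma> h \<psi>) * ?D l \<chi>
        + c i j l * ?D i \<phi> * ?D j \<psi> * ?D l (lie_deriv \<tau> h \<chi>)" for i j l
    proof -
      have w: "\<kappa> + \<gamma> + \<tau> + real k =
        real k - real (i + j + l) + (\<kappa> + real i) + (\<gamma> + real j) + (\<tau> + real l)" by simp
      show ?thesis
        unfolding w lie_deriv_mult higher_pderiv_lie_deriv_affine[OF h] e_def
        by (simp add: algebra_simps)
    qed
    from inv have "lie_deriv (\<kappa> + \<gamma> + \<tau> + real k) h (tern_diffop k c (\<phi>, \<psi>, \<chi>)) =
        tern_diffop k c (lie_deriv \<kappa> h \<phi>, \<psi>, \<chi>) + tern_diffop k c (\<phi>, lie_deriv \<gamma> h \<psi>, \<chi>)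
        + tern_diffop k c (\<phi>, \<psi>, lie_deriv \<tau> h \<chi>)"
      by (simp add: vect_invariant_def)
    then show ?thesis
      by (simp add: tern_diffop_def lie_deriv_sum term_eq sum.distrib)
  qed
  then show ?thesis using tern_diffop_eq_0D[of k e] le by (simp add: e_def)
qed

text \<open>
  The field \<open>d/dx\<close> shows that a coefficient is constant; \<open>x d/dx\<close> multiplies a constant by its
  weight \<open>k - (i + j + l)\<close>, so this constant is zero unless \<open>i + j + l = k\<close>.
\<close>
lemma invariant_coeff_const:
  assumes "vect_invariant ((\<kappa>, \<gamma>, \<tau>), \<kappa> + \<gamma> + \<tau> + real k, tern_diffop k c)"
    and "i + j + l \<le> k"
  shows "c i j l = [:coeff (c i j l) 0:]" and "i + j + l < k \<Longrightarrow> c i j l = 0"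
proof -
  have const: "pderiv (c i j l) = 0"
    using vect_invariant_coeffs[OF assms, of 1] by (simp add: lie_deriv_def)
  then obtain a where "c i j l = [:a:]" using pderiv_iszero by blast
  then show "c i j l = [:coeff (c i j l) 0:]" by simp
  show "c i j l = 0" if "i + j + l < k"
    using vect_invariant_coeffs[OF assms, of "[:0, 1:]"] const that
    by (simp add: lie_deriv_def pderiv_pCons)
qed

section \<open>The equations for the coefficients\<close>

definition op1 :: "real \<Rightarrow> real \<Rightarrow> real \<Rightarrow> tern_op" where
  "op1 a b c = (\<lambda>(\<phi>, \<psi>, \<chi>).
     smult a (pderiv \<phi> * \<psi> * \<chi>) + smult b (\<phi> * pderiv \<psi> * \<chi>) + smult c (\<phi> * \<psi> * pderiv \<chi>))"

definition op2 :: "real \<Rightarrow> real \<Rightarrow> real \<Rightarrow> real \<Rightarrow> real \<Rightarrow> real \<Rightarrow> tern_op" where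
  "op2 a b c p q r = (\<lambda>(\<phi>, \<psi>, \<chi>).
     smult a (pderiv (pderiv \<phi>) * \<psi> * \<chi>) + smult b (\<phi> * pderiv (pderiv \<psi>) * \<chi>)
     + smult c (\<phi> * \<psi> * pderiv (pderiv \<chi>))
     + smult p (pderiv \<phi> * pderiv \<psi> * \<chi>) + smult q (pderiv \<phi> * \<psi> * pderiv \<chi>)
     + smult r (\<phi> * pderiv \<psi> * pderiv \<chi>))"

text \<open>
  In the order of the equations: the cancellation of \<open>h'''\<phi>\<psi>\<chi>\<close> and of \<open>h''\<phi>'\<psi>\<chi>\<close>,
  \<open>h''\<phi>\<psi>'\<chi>\<close>, \<open>h''\<phi>\<psi>\<chi>'\<close> in the failure of \<^term>\<open>op2 a b c p q r\<close> to commute with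
  \<open>h d/dx\<close>.
\<close>
definition anomaly_free2 where
  "anomaly_free2 \<kappa> \<gamma> \<tau> a b c p q r \<longleftrightarrow>
     a * \<kappa> + b * \<gamma> + c * \<tau> = (0::real) \<and>
     a * (1 + 2 * \<kappa>) + p * \<gamma> + q * \<tau> = 0 \<and>
     b * (1 + 2 * \<gamma>) + p * \<kappa> + r * \<tau> = 0 \<and>
     c * (1 + 2 * \<tau>) + q * \<kappa> + r * \<gamma> = 0"

lemma invariant_order1:
  assumes "is_tern_diffop 1 A" and inv: "vect_invariant ((\<kappa>, \<gamma>, \<tau>), \<kappa> + \<gamma> + \<tau> + 1, A)"
  obtains a b c where "A = op1 a b c" and "a * \<kappa> + b * \<gamma> + c * \<tau> = 0"
proof -
  from assms(1) obtain C where C: "A = tern_diffop 1 C" by (auto simp: is_tern_diffop_def)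
  note coeffs = invariant_coeff_const[of \<kappa> \<gamma> \<tau> 1 C, simplified, OF inv[unfolded C, simplified]]
  obtain a b c where *: "C 1 0 0 = [:a:]" "C 0 1 0 = [:b:]" "C 0 0 1 = [:c:]"
    using coeffs(1)[of 1 0 0] coeffs(1)[of 0 1 0] coeffs(1)[of 0 0 1] by auto
  have A: "A = op1 a b c"
    using * coeffs(2)[of 0 0 0]
    by (auto simp: C tern_diffop_def op1_def fun_eq_iff algebra_simps)
  \<comment> \<open>On constants only the anomaly is left; \<open>h = x\<^sup>2\<close> detects the coefficient of \<open>h''\<close>.\<close>
  have "lie_deriv (\<kappa> + \<gamma> + \<tau> + 1) (monom 1 2) (A (1, 1, 1)) =
      A (lie_deriv \<kappa> (monom 1 2) 1, 1, 1) + A (1, lie_deriv \<gamma> (monom 1 2) 1, 1)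
      + A (1, 1, lie_deriv \<tau> (monom 1 2) 1)"
    using inv by (simp add: vect_invariant_def)
  then have "a * \<kappa> + b * \<gamma> + c * \<tau> = 0"
    by (simp add: A op1_def lie_deriv_def pderiv_monom pderiv_smult monom_0 flip: distrib_left)
  with A show ?thesis by (rule that)
qed

lemma invariant_order2:
  assumes "is_tern_diffop 2 A" and inv: "vect_invariant ((\<kappa>, \<gamma>, \<tau>), \<kappa> + \<gamma> + \<tau> + 2, A)"
  obtains a b c p q r where "A = op2 a b c p q r" and "anomaly_free2 \<kappa> \<gamma> \<tau> a b c p q r"
proof -
  from assms(1) obtain C where C: "A = tern_diffop 2 C" by (auto simp: is_tern_diffop_def)
  note coeffs = invariant_coeff_const[of \<kappa> \<gamma> \<tau> 2 C, simplified, OF inv[unfolded C, simplified]]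
  obtain a b c p q r where *: "C 2 0 0 = [:a:]" "C 0 2 0 = [:b:]" "C 0 0 2 = [:c:]"
      "C 1 1 0 = [:p:]" "C 1 0 1 = [:q:]" "C 0 1 1 = [:r:]"
    using coeffs(1)[of 2 0 0] coeffs(1)[of 0 2 0] coeffs(1)[of 0 0 2]
      coeffs(1)[of 1 1 0] coeffs(1)[of 1 0 1] coeffs(1)[of 0 1 1] by auto
  have A: "A = op2 a b c p q r"
    using * coeffs(2)[of 0 0 0] coeffs(2)[of 1 0 0] coeffs(2)[of 0 1 0] coeffs(2)[of 0 0 1]
    by (auto simp: C tern_diffop_def op2_def fun_eq_iff numeral_2_eq_2 algebra_simps)
  have inv': "poly (lie_deriv (\<kappa> + \<gamma> + \<tau> + 2) h (A (\<phi>, \<psi>, \<chi>))) 1 =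
      poly (A (lie_deriv \<kappa> h \<phi>, \<psi>, \<chi>) + A (\<phi>, lie_deriv \<gamma> h \<psi>, \<chi>)
        + A (\<phi>, \<psi>, lie_deriv \<tau> h \<chi>)) 1" for h \<phi> \<psi> \<chi>
    using inv by (simp add: vect_invariant_def)
  \<comment> \<open>The field with \<open>h = x\<^sup>3\<close> on constants gives the \<open>h'''\<close> equation; \<open>h = x\<^sup>2\<close>, with \<open>x\<close> in one
    argument and constants in the others, gives the \<open>h''\<close> equation of that argument.
    All values are then monomials of the same degree, so that evaluation at 1 loses nothing.\<close>
  note comp = A op2_def lie_deriv_def pderiv_monom pderiv_smult pderiv_add pderiv_mult pderiv_pCons
    power2_eq_square power3_eq_cube poly_monom
  have "anomaly_free2 \<kappa> \<gamma> \<tau> a b c p q r"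
    unfolding anomaly_free2_def
    using inv'[of "monom 1 3" 1 1 1] inv'[of "monom 1 2" "[:0, 1:]" 1 1]
      inv'[of "monom 1 2" 1 "[:0, 1:]" 1] inv'[of "monom 1 2" 1 1 "[:0, 1:]"]
    by (simp add: comp algebra_simps)
  with A show ?thesis by (rule that)
qed

section \<open>Permutations and dualizations on coefficients\<close>

lemma perm_dual_swap12:
  assumes "perm_dual X ((\<kappa>, \<gamma>, \<tau>), \<mu>, A)"
  shows "perm_dual X ((\<gamma>, \<kappa>, \<tau>), \<mu>, \<lambda>(\<phi>, \<psi>, \<chi>). A (\<psi>, \<phi>, \<chi>))"
proof -
  have "transpose 0 1 permutes {0, 1, 2::nat}" by (rule permutes_swap_id) auto
  from perm_dual.permutation[OF assms this] show ?thesis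
    by (simp add: perm3_def transpose_def case_prod_unfold)
qed

lemma perm_dual_swap23:
  assumes "perm_dual X ((\<kappa>, \<gamma>, \<tau>), \<mu>, A)"
  shows "perm_dual X ((\<kappa>, \<tau>, \<gamma>), \<mu>, \<lambda>(\<phi>, \<psi>, \<chi>). A (\<phi>, \<chi>, \<psi>))"
proof -
  have "transpose 1 2 permutes {0, 1, 2::nat}" by (rule permutes_swap_id) auto
  from perm_dual.permutation[OF assms this] show ?thesis
    by (simp add: perm3_def transpose_def case_prod_unfold)
qed

text \<open>
  The weights of the operators in the orbit of \<open>X\<close>. The equations are carried along, since it is
  easier to see that swaps and dualization preserve them than to derive them from invariance again.
\<close>
definition reaches1 :: "weighted_op \<Rightarrow> real \<Rightarrow> real \<Rightarrow> real \<Rightarrow> bool" where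
  "reaches1 X \<kappa> \<gamma> \<tau> \<longleftrightarrow> (\<exists>a b c. perm_dual X ((\<kappa>, \<gamma>, \<tau>), \<kappa> + \<gamma> + \<tau> + 1, op1 a b c) \<and>
     a * \<kappa> + b * \<gamma> + c * \<tau> = 0)"

definition reaches2 :: "weighted_op \<Rightarrow> real \<Rightarrow> real \<Rightarrow> real \<Rightarrow> bool" where
  "reaches2 X \<kappa> \<gamma> \<tau> \<longleftrightarrow> (\<exists>a b c p q r.
     perm_dual X ((\<kappa>, \<gamma>, \<tau>), \<kappa> + \<gamma> + \<tau> + 2, op2 a b c p q r) \<and>
     anomaly_free2 \<kappa> \<gamma> \<tau> a b c p q r)"

lemma reaches1_swap12:
  assumes "reaches1 X \<kappa> \<gamma> \<tau>" shows "reaches1 X \<gamma> \<kappa> \<tau>"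
proof -
  from assms obtain a b c where
    r: "perm_dual X ((\<kappa>, \<gamma>, \<tau>), \<kappa> + \<gamma> + \<tau> + 1, op1 a b c)" and e: "a * \<kappa> + b * \<gamma> + c * \<tau> = 0"
    by (auto simp: reaches1_def)
  have "(\<lambda>(\<phi>, \<psi>, \<chi>). op1 a b c (\<psi>, \<phi>, \<chi>)) = op1 b a c"
    by (auto simp: op1_def algebra_simps)
  with perm_dual_swap12[OF r] e show ?thesis
    unfolding reaches1_def
    by (intro exI[of _ b] exI[of _ a] exI[of _ c]) (simp add: algebra_simps)
qed

lemma reaches1_swap23:
  assumes "reaches1 X \<kappa> \<gamma> \<tau>" shows "reaches1 X \<kappa> \<tau> \<gamma>"
proof -
  from assms obtain a b c where
    r: "perm_dual X ((\<kappa>, \<gamma>, \<tau>), \<kappa> + \<gamma> + \<tau> + 1, op1 a b c)" and e: "a * \<kappa> + b * \<gamma> + c * \<tau> = 0"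
    by (auto simp: reaches1_def)
  have "(\<lambda>(\<phi>, \<psi>, \<chi>). op1 a b c (\<phi>, \<chi>, \<psi>)) = op1 a c b"
    by (auto simp: op1_def algebra_simps)
  with perm_dual_swap23[OF r] e show ?thesis
    unfolding reaches1_def
    by (intro exI[of _ a] exI[of _ c] exI[of _ b]) (simp add: algebra_simps)
qed

lemma reaches2_swap12:
  assumes "reaches2 X \<kappa> \<gamma> \<tau>" shows "reaches2 X \<gamma> \<kappa> \<tau>"
proof -
  from assms obtain a b c p q r where
    o: "perm_dual X ((\<kappa>, \<gamma>, \<tau>), \<kappa> + \<gamma> + \<tau> + 2, op2 a b c p q r)"
    and e: "anomaly_free2 \<kappa> \<gamma> \<tau> a b c p q r"
    by (auto simp: reaches2_def)
  have "(\<lambda>(\<phi>, \<psi>, \<chi>). op2 a b c p q r (\<psi>, \<phi>, \<chi>)) = op2 b a c p r q"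
    by (auto simp: op2_def algebra_simps)
  with perm_dual_swap12[OF o] have "perm_dual X ((\<gamma>, \<kappa>, \<tau>), \<gamma> + \<kappa> + \<tau> + 2, op2 b a c p r q)"
    by (simp add: add_ac)
  moreover have "anomaly_free2 \<gamma> \<kappa> \<tau> b a c p r q"
    using e by (simp add: anomaly_free2_def add_ac)
  ultimately show ?thesis unfolding reaches2_def by blast
qed

lemma reaches2_swap23:
  assumes "reaches2 X \<kappa> \<gamma> \<tau>" shows "reaches2 X \<kappa> \<tau> \<gamma>"
proof -
  from assms obtain a b c p q r where
    o: "perm_dual X ((\<kappa>, \<gamma>, \<tau>), \<kappa> + \<gamma> + \<tau> + 2, op2 a b c p q r)"
    and e: "anomaly_free2 \<kappa> \<gamma> \<tau> a b c p q r"
    by (auto simp: reaches2_def)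
  have "(\<lambda>(\<phi>, \<psi>, \<chi>). op2 a b c p q r (\<phi>, \<chi>, \<psi>)) = op2 a c b q p r"
    by (auto simp: op2_def algebra_simps)
  with perm_dual_swap23[OF o] have "perm_dual X ((\<kappa>, \<tau>, \<gamma>), \<kappa> + \<tau> + \<gamma> + 2, op2 a c b q p r)"
    by (simp add: add_ac)
  moreover have "anomaly_free2 \<kappa> \<tau> \<gamma> a c b q p r"
    using e by (simp add: anomaly_free2_def add_ac)
  ultimately show ?thesis unfolding reaches2_def by blast
qed

text \<open>
  The coefficients of the adjoint come from the product rule applied to
  \<open>a (\<omega>\<psi>\<chi>)'' - p (\<omega>\<psi>'\<chi>)' - q (\<omega>\<psi>\<chi>')' + b \<omega>\<psi>''\<chi> + c \<omega>\<psi>\<chi>'' + r \<omega>\<psi>'\<chi>'\<close>.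
\<close>
lemma perm_dual_op2_adjoint1:
  assumes "perm_dual X ((\<kappa>, \<gamma>, \<tau>), \<mu>, op2 a b c p q r)"
  shows "perm_dual X ((1 - \<mu>, \<gamma>, \<tau>), 1 - \<kappa>,
    op2 a (a + b - p) (a + c - q) (2 * a - p) (2 * a - q) (2 * a - p - q + r))"
proof -
  define C :: "nat \<Rightarrow> nat \<Rightarrow> nat \<Rightarrow> real poly" where
    "C = (\<lambda>i j l. if (i, j, l) = (2, 0, 0) then [:a:] else if (i, j, l) = (0, 2, 0) then [:b:]
       else if (i, j, l) = (0, 0, 2) then [:c:] else if (i, j, l) = (1, 1, 0) then [:p:]
       else if (i, j, l) = (1, 0, 1) then [:q:] else if (i, j, l) = (0, 1, 1) then [:r:] else 0)"
  have "tern_diffop 2 C = op2 a b c p q r"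
    by (auto simp: C_def tern_diffop_def op2_def fun_eq_iff numeral_2_eq_2 algebra_simps)
  moreover have "adjoint1 2 C =
      op2 a (a + b - p) (a + c - q) (2 * a - p) (2 * a - q) (2 * a - p - q + r)"
    by (auto simp: C_def adjoint1_def op2_def fun_eq_iff numeral_2_eq_2 pderiv_mult pderiv_add
        pderiv_smult algebra_simps simp flip: poly_eq_poly_eq_iff)
  ultimately show ?thesis using perm_dual.dual1[of X \<kappa> \<gamma> \<tau> \<mu> 2 C] assms by simp
qed

text \<open>
  Dualization exchanges the first weight with the fourth one, \<open>- 1 - \<kappa> - \<gamma> - \<tau>\<close>. Together with
  the two swaps this generates all permutations of the four weights.
\<close>
lemma reaches2_dual1:
  assumes "reaches2 X \<kappa> \<gamma> \<tau>" shows "reaches2 X (- 1 - \<kappa> - \<gamma> - \<tau>) \<gamma> \<tau>"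
proof -
  from assms obtain a b c p q r where
    o: "perm_dual X ((\<kappa>, \<gamma>, \<tau>), \<kappa> + \<gamma> + \<tau> + 2, op2 a b c p q r)"
    and e: "anomaly_free2 \<kappa> \<gamma> \<tau> a b c p q r"
    by (auto simp: reaches2_def)
  let ?\<nu> = "- 1 - \<kappa> - \<gamma> - \<tau>"
  have "1 - (\<kappa> + \<gamma> + \<tau> + 2) = ?\<nu>" "1 - \<kappa> = ?\<nu> + \<gamma> + \<tau> + 2" by simp_all
  with perm_dual_op2_adjoint1[OF o] have "perm_dual X ((?\<nu>, \<gamma>, \<tau>), ?\<nu> + \<gamma> + \<tau> + 2,
      op2 a (a + b - p) (a + c - q) (2 * a - p) (2 * a - q) (2 * a - p - q + r))"
    by metis
  moreover have "anomaly_free2 ?\<nu> \<gamma> \<tau>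
      a (a + b - p) (a + c - q) (2 * a - p) (2 * a - q) (2 * a - p - q + r)"
    using e unfolding anomaly_free2_def by (simp add: algebra_simps)
  ultimately show ?thesis unfolding reaches2_def by blast
qed

text \<open>
  If two of the four weights are zero, they are moved to the first two places. Otherwise a single
  zero is hidden in the fourth place.
\<close>
lemma reaches2_arrange:
  assumes "reaches2 X \<kappa> \<gamma> \<tau>"
  obtains (two_zeros) \<tau>' where "reaches2 X 0 0 \<tau>'"
  | (nonzero) \<kappa>' \<gamma>' \<tau>' where "reaches2 X \<kappa>' \<gamma>' \<tau>'" "\<kappa>' \<noteq> 0" "\<gamma>' \<noteq> 0" "\<tau>' \<noteq> 0"
proof -
  have first_zero: thesis if r: "reaches2 X 0 \<gamma> \<tau>" for \<gamma> \<tau>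
  proof -
    consider "\<gamma> = 0" | "\<tau> = 0" | "- 1 - \<gamma> - \<tau> = 0" | "- 1 - \<gamma> - \<tau> \<noteq> 0" "\<gamma> \<noteq> 0" "\<tau> \<noteq> 0"
      by blast
    then show thesis
    proof cases
      case 1
      with r show thesis by (auto intro: two_zeros)
    next
      case 2
      with reaches2_swap23[OF r] show thesis by (auto intro: two_zeros)
    next
      \<comment> \<open>The zero input moves to the second place, and the zero fourth weight replaces the first.\<close>
      case 3
      with reaches2_dual1[OF reaches2_swap12[OF r]] show thesis by (auto intro: two_zeros)
    next
      case 4
      with reaches2_dual1[OF r] show thesis by (auto intro: nonzero)
    qed
  qed
  consider "\<kappa> = 0" | "\<gamma> = 0" | "\<tau> = 0" | "\<kappa> \<noteq> 0" "\<gamma> \<noteq> 0" "\<tau> \<noteq> 0" by blast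
  then show thesis
    using assms reaches2_swap12 reaches2_swap23 first_zero nonzero by cases blast+
qed

section \<open>Expression by brackets\<close>

lemma op1_bracket_form:
  assumes "a * \<kappa> + b * \<gamma> + c * \<tau> = 0" "\<kappa> \<noteq> 0"
  shows "op1 a b c (\<phi>, \<psi>, \<chi>) =
    smult (- b / \<kappa>) (poisson \<kappa> \<gamma> \<phi> \<psi> * \<chi>) + smult (- c / \<kappa>) (poisson \<kappa> \<tau> \<phi> \<chi> * \<psi>)"
proof -
  have a: "a = - (b * \<gamma> + c * \<tau>) / \<kappa>"
    using assms by (simp add: field_simps)
  show ?thesis unfolding a using assms(2)
    by (intro poly_eq_poly_eq_iff[THEN iffD1] ext) (simp add: op1_def poisson_def field_simps)
qed

lemma op2_bracket_form_two_zeros: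
  assumes "anomaly_free2 0 0 \<tau> a b c p q r"
  shows "op2 a b c p q r (\<phi>, \<psi>, \<chi>) =
    smult p (poisson 0 1 \<phi> (de_Rham \<psi>) * \<chi>) + smult q (poisson \<tau> 1 \<chi> (de_Rham \<phi>) * \<psi>)
    + smult (- r) (poisson 1 \<tau> (de_Rham \<psi>) \<chi> * \<phi>)"
proof -
  from assms have "c = 0" "a = - q * \<tau>" "b = - r * \<tau>"
    by (auto simp: anomaly_free2_def)
  then show ?thesis
    by (intro poly_eq_poly_eq_iff[THEN iffD1] ext)
       (simp add: op2_def poisson_def de_Rham_def algebra_simps)
qed

lemma poisson_poisson_12:
  "poisson (\<kappa> + \<gamma> + 1) \<tau> (poisson \<kappa> \<gamma> \<phi> \<psi>) \<chi> =
    op2 (\<gamma> * \<tau>) (- \<kappa> * \<tau>) 0 (\<tau> * (\<gamma> - \<kappa>)) (- (\<kappa> + \<gamma> + 1) * \<gamma>) ((\<kappa> + \<gamma> + 1) * \<kappa>) (\<phi>, \<psi>, \<chi>)"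
  by (intro poly_eq_poly_eq_iff[THEN iffD1] ext)
     (simp add: op2_def poisson_def pderiv_mult pderiv_diff pderiv_smult algebra_simps)

lemma poisson_poisson_13:
  "poisson (\<kappa> + \<tau> + 1) \<gamma> (poisson \<kappa> \<tau> \<phi> \<chi>) \<psi> =
    op2 (\<gamma> * \<tau>) 0 (- \<kappa> * \<gamma>) (- (\<kappa> + \<tau> + 1) * \<tau>) (\<gamma> * (\<tau> - \<kappa>)) ((\<kappa> + \<tau> + 1) * \<kappa>) (\<phi>, \<psi>, \<chi>)"
  by (intro poly_eq_poly_eq_iff[THEN iffD1] ext)
     (simp add: op2_def poisson_def pderiv_mult pderiv_diff pderiv_smult algebra_simps)

lemma op2_lincomb:
  "smult x (op2 a b c p q r t) + smult y (op2 a' b' c' p' q' r' t) =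
    op2 (x * a + y * a') (x * b + y * b') (x * c + y * c')
      (x * p + y * p') (x * q + y * q') (x * r + y * r') t"
  by (cases t) (simp add: op2_def smult_add_left smult_add_right algebra_simps)

text \<open>
  The difference of the two solutions has \<open>b = c = 0\<close>. The first equation then gives \<open>a = 0\<close>, and
  the other three become a homogeneous system for \<open>p, q, r\<close> of determinant \<open>- 2\<kappa>\<gamma>\<tau>\<close>.
\<close>
lemma anomaly_free2_unique:
  assumes "anomaly_free2 \<kappa> \<gamma> \<tau> a b c p q r" "anomaly_free2 \<kappa> \<gamma> \<tau> a' b c p' q' r'"
    and nz: "\<kappa> \<noteq> 0" "\<gamma> \<noteq> 0" "\<tau> \<noteq> 0"
  shows "a = a'" "p = p'" "q = q'" "r = r'"
proof -
  have "a * \<kappa> = a' * \<kappa>"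
    using assms(1,2) unfolding anomaly_free2_def by linarith
  with nz show a: "a = a'" by simp
  define P Q R where "P = p - p'" and "Q = q - q'" and "R = r - r'"
  have e: "P * \<gamma> + Q * \<tau> = 0" "P * \<kappa> + R * \<tau> = 0" "Q * \<kappa> + R * \<gamma> = 0"
    using assms(1,2) a by (simp_all add: anomaly_free2_def P_def Q_def R_def algebra_simps)
  have "2 * (\<gamma> * \<kappa>) * P = \<kappa> * (P * \<gamma> + Q * \<tau>) + \<gamma> * (P * \<kappa> + R * \<tau>) - \<tau> * (Q * \<kappa> + R * \<gamma>)"
    by (simp add: algebra_simps)
  then have "P = 0" using e nz by simp
  with e nz have "Q = 0" "R = 0" by simp_all
  with \<open>P = 0\<close> show "p = p'" "q = q'" "r = r'" by (simp_all add: P_def Q_def R_def)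
qed

text \<open>
  The factors are chosen so that the combination of the brackets has the given \<open>b\<close> and \<open>c\<close>. Both
  sides satisfy the equations, so the remaining coefficients agree by uniqueness.
\<close>
lemma op2_bracket_form:
  assumes free: "anomaly_free2 \<kappa> \<gamma> \<tau> a b c p q r" and nz: "\<kappa> \<noteq> 0" "\<gamma> \<noteq> 0" "\<tau> \<noteq> 0"
  shows "op2 a b c p q r (\<phi>, \<psi>, \<chi>) =
    smult (- b / (\<kappa> * \<tau>)) (poisson (\<kappa> + \<gamma> + 1) \<tau> (poisson \<kappa> \<gamma> \<phi> \<psi>) \<chi>)
    + smult (- c / (\<kappa> * \<gamma>)) (poisson (\<kappa> + \<tau> + 1) \<gamma> (poisson \<kappa> \<tau> \<phi> \<chi>) \<psi>)"
proof -
  define x y where "x = - b / (\<kappa> * \<tau>)" and "y = - c / (\<kappa> * \<gamma>)"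
  define a' p' q' r' where "a' = x * (\<gamma> * \<tau>) + y * (\<gamma> * \<tau>)"
    and "p' = x * (\<tau> * (\<gamma> - \<kappa>)) + y * (- (\<kappa> + \<tau> + 1) * \<tau>)"
    and "q' = x * (- (\<kappa> + \<gamma> + 1) * \<gamma>) + y * (\<gamma> * (\<tau> - \<kappa>))"
    and "r' = x * ((\<kappa> + \<gamma> + 1) * \<kappa>) + y * ((\<kappa> + \<tau> + 1) * \<kappa>)"
  note primed = a'_def p'_def q'_def r'_def
  have bc: "b = x * (- \<kappa> * \<tau>) + y * 0" "c = x * 0 + y * (- \<kappa> * \<gamma>)"
    using nz by (simp_all add: x_def y_def)
  have "anomaly_free2 \<kappa> \<gamma> \<tau> a' b c p' q' r'"
    unfolding anomaly_free2_def bc primed by (simp add: algebra_simps)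
  from anomaly_free2_unique[OF free this nz]
  have "a = a'" "p = p'" "q = q'" "r = r'" .
  then show ?thesis
    unfolding x_def[symmetric] y_def[symmetric] poisson_poisson_12[of \<kappa> \<gamma> \<tau> \<phi> \<psi> \<chi>]
      poisson_poisson_13[of \<kappa> \<tau> \<gamma> \<phi> \<chi> \<psi>]
      op2_lincomb bc[symmetric] primed[symmetric] by simp
qed

section \<open>The classification\<close>

theorem theorem2p1:
  "(\<forall>(\<kappa>::real) (\<gamma>::real) (\<tau>::real) (A::tern_op).
      is_tern_diffop 1 A \<and> vect_invariant ((\<kappa>, \<gamma>, \<tau>), \<kappa> + \<gamma> + \<tau> + 1, A) \<longrightarrow>
      (\<exists>\<kappa>' \<gamma>' \<tau>' B.
         perm_dual ((\<kappa>, \<gamma>, \<tau>), \<kappa> + \<gamma> + \<tau> + 1, A) ((\<kappa>', \<gamma>', \<tau>'), \<kappa>' + \<gamma>' + \<tau>' + 1, B) \<and>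
         ((\<kappa>', \<gamma>', \<tau>') = (0, 0, 0) \<and>
            (\<exists>m \<epsilon>1 \<epsilon>2 \<epsilon>3. \<forall>\<phi> \<psi> \<chi>. B (\<phi>, \<psi>, \<chi>) =
               smult m (smult \<epsilon>1 (de_Rham \<phi> * \<psi> * \<chi>) + smult \<epsilon>2 (\<phi> * de_Rham \<psi> * \<chi>)
                 + smult \<epsilon>3 (\<phi> * \<psi> * de_Rham \<chi>)))
          \<or> \<kappa>' \<noteq> 0 \<and>
            (\<exists>m \<epsilon>1 \<epsilon>2. \<forall>\<phi> \<psi> \<chi>. B (\<phi>, \<psi>, \<chi>) =
               smult m (smult \<epsilon>1 (poisson \<kappa>' \<gamma>' \<phi> \<psi> * \<chi>) + smult \<epsilon>2 (poisson \<kappa>' \<tau>' \<phi> \<chi> * \<psi>))))))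
   \<and>
   (\<forall>(\<kappa>::real) (\<gamma>::real) (\<tau>::real) (A::tern_op).
      is_tern_diffop 2 A \<and> vect_invariant ((\<kappa>, \<gamma>, \<tau>), \<kappa> + \<gamma> + \<tau> + 2, A) \<longrightarrow>
      (\<exists>\<kappa>' \<gamma>' \<tau>' B.
         perm_dual ((\<kappa>, \<gamma>, \<tau>), \<kappa> + \<gamma> + \<tau> + 2, A) ((\<kappa>', \<gamma>', \<tau>'), \<kappa>' + \<gamma>' + \<tau>' + 2, B) \<and>
         ((\<gamma>', \<kappa>') = (0, 0) \<and>
            (\<exists>m \<epsilon>1 \<epsilon>2 \<epsilon>3. \<forall>\<phi> \<psi> \<chi>. B (\<phi>, \<psi>, \<chi>) =
               smult m (smult \<epsilon>1 (poisson 0 1 \<phi> (de_Rham \<psi>) * \<chi>)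
                 + smult \<epsilon>2 (poisson \<tau>' 1 \<chi> (de_Rham \<phi>) * \<psi>)
                 + smult \<epsilon>3 (poisson 1 \<tau>' (de_Rham \<psi>) \<chi> * \<phi>)))
          \<or> (\<gamma>', \<kappa>') \<noteq> (0, 0) \<and>
            (\<exists>m \<epsilon>1 \<epsilon>2. \<forall>\<phi> \<psi> \<chi>. B (\<phi>, \<psi>, \<chi>) =
               smult m
                 (smult \<epsilon>1 (poisson (\<kappa>' + \<gamma>' + 1) \<tau>' (poisson \<kappa>' \<gamma>' \<phi> \<psi>) \<chi>)
                + smult \<epsilon>2 (poisson (\<kappa>' + \<tau>' + 1) \<gamma>' (poisson \<kappa>' \<tau>' \<phi> \<chi>) \<psi>))))))"
proof (intro conjI allI impI; elim conjE)
  fix \<kappa> \<gamma> \<tau> :: real and A :: tern_op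
  assume A: "is_tern_diffop 1 A" "vect_invariant ((\<kappa>, \<gamma>, \<tau>), \<kappa> + \<gamma> + \<tau> + 1, A)"
  let ?X = "((\<kappa>, \<gamma>, \<tau>), \<kappa> + \<gamma> + \<tau> + 1, A)"
  let ?Brackets = "\<lambda>\<kappa>' \<gamma>' \<tau>' B. \<exists>m \<epsilon>1 \<epsilon>2. \<forall>\<phi> \<psi> \<chi>. B (\<phi>, \<psi>, \<chi>) =
    smult m (smult \<epsilon>1 (poisson \<kappa>' \<gamma>' \<phi> \<psi> * \<chi>) + smult \<epsilon>2 (poisson \<kappa>' \<tau>' \<phi> \<chi> * \<psi>))"
  from A obtain a b c where op: "A = op1 a b c" and e: "a * \<kappa> + b * \<gamma> + c * \<tau> = 0"
    by (rule invariant_order1)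
  then have r: "reaches1 ?X \<kappa> \<gamma> \<tau>"
    unfolding reaches1_def by (blast intro: perm_dual.refl)
  show "\<exists>\<kappa>' \<gamma>' \<tau>' B. perm_dual ?X ((\<kappa>', \<gamma>', \<tau>'), \<kappa>' + \<gamma>' + \<tau>' + 1, B) \<and>
      ((\<kappa>', \<gamma>', \<tau>') = (0, 0, 0) \<and>
         (\<exists>m \<epsilon>1 \<epsilon>2 \<epsilon>3. \<forall>\<phi> \<psi> \<chi>. B (\<phi>, \<psi>, \<chi>) =
            smult m (smult \<epsilon>1 (de_Rham \<phi> * \<psi> * \<chi>) + smult \<epsilon>2 (\<phi> * de_Rham \<psi> * \<chi>)
              + smult \<epsilon>3 (\<phi> * \<psi> * de_Rham \<chi>)))
       \<or> \<kappa>' \<noteq> 0 \<and> ?Brackets \<kappa>' \<gamma>' \<tau>' B)"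
  proof (cases "(\<kappa>, \<gamma>, \<tau>) = (0, 0, 0)")
    case True
    have "\<exists>m \<epsilon>1 \<epsilon>2 \<epsilon>3. \<forall>\<phi> \<psi> \<chi>. A (\<phi>, \<psi>, \<chi>) =
        smult m (smult \<epsilon>1 (de_Rham \<phi> * \<psi> * \<chi>) + smult \<epsilon>2 (\<phi> * de_Rham \<psi> * \<chi>)
          + smult \<epsilon>3 (\<phi> * \<psi> * de_Rham \<chi>))"
      by (intro exI[of _ 1] exI[of _ a] exI[of _ b] exI[of _ c]) (simp add: op op1_def de_Rham_def)
    with True perm_dual.refl[of ?X] show ?thesis by blast
  next
    case False
    then consider "\<kappa> \<noteq> 0" | "\<gamma> \<noteq> 0" | "\<tau> \<noteq> 0" by auto
    then obtain \<kappa>' \<gamma>' \<tau>' where "reaches1 ?X \<kappa>' \<gamma>' \<tau>'" and nz: "\<kappa>' \<noteq> 0"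
      using r reaches1_swap12 reaches1_swap23 by cases metis+
    then obtain a b c where o: "perm_dual ?X ((\<kappa>', \<gamma>', \<tau>'), \<kappa>' + \<gamma>' + \<tau>' + 1, op1 a b c)"
      and e: "a * \<kappa>' + b * \<gamma>' + c * \<tau>' = 0"
      unfolding reaches1_def by blast
    have "?Brackets \<kappa>' \<gamma>' \<tau>' (op1 a b c)"
      using op1_bracket_form[OF e nz]
      by (intro exI[of _ 1] exI[of _ "- b / \<kappa>'"] exI[of _ "- c / \<kappa>'"]) simp
    with o nz show ?thesis by blast
  qed
next
  fix \<kappa> \<gamma> \<tau> :: real and A :: tern_op
  assume A: "is_tern_diffop 2 A" "vect_invariant ((\<kappa>, \<gamma>, \<tau>), \<kappa> + \<gamma> + \<tau> + 2, A)"
  let ?X = "((\<kappa>, \<gamma>, \<tau>), \<kappa> + \<gamma> + \<tau> + 2, A)"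
  let ?TwoZeros = "\<lambda>\<tau>' B. \<exists>m \<epsilon>1 \<epsilon>2 \<epsilon>3. \<forall>\<phi> \<psi> \<chi>. B (\<phi>, \<psi>, \<chi>) =
    smult m (smult \<epsilon>1 (poisson 0 1 \<phi> (de_Rham \<psi>) * \<chi>)
      + smult \<epsilon>2 (poisson \<tau>' 1 \<chi> (de_Rham \<phi>) * \<psi>)
      + smult \<epsilon>3 (poisson 1 \<tau>' (de_Rham \<psi>) \<chi> * \<phi>))"
  let ?Brackets = "\<lambda>\<kappa>' \<gamma>' \<tau>' B. \<exists>m \<epsilon>1 \<epsilon>2. \<forall>\<phi> \<psi> \<chi>. B (\<phi>, \<psi>, \<chi>) =
    smult m (smult \<epsilon>1 (poisson (\<kappa>' + \<gamma>' + 1) \<tau>' (poisson \<kappa>' \<gamma>' \<phi> \<psi>) \<chi>)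
      + smult \<epsilon>2 (poisson (\<kappa>' + \<tau>' + 1) \<gamma>' (poisson \<kappa>' \<tau>' \<phi> \<chi>) \<psi>))"
  from A obtain a b c p q r where "A = op2 a b c p q r" "anomaly_free2 \<kappa> \<gamma> \<tau> a b c p q r"
    by (rule invariant_order2)
  then have "reaches2 ?X \<kappa> \<gamma> \<tau>"
    unfolding reaches2_def by (blast intro: perm_dual.refl)
  then show "\<exists>\<kappa>' \<gamma>' \<tau>' B. perm_dual ?X ((\<kappa>', \<gamma>', \<tau>'), \<kappa>' + \<gamma>' + \<tau>' + 2, B) \<and>
      ((\<gamma>', \<kappa>') = (0, 0) \<and> ?TwoZeros \<tau>' B \<or> (\<gamma>', \<kappa>') \<noteq> (0, 0) \<and> ?Brackets \<kappa>' \<gamma>' \<tau>' B)"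
  proof (cases rule: reaches2_arrange)
    case (two_zeros \<tau>')
    then obtain a b c p q r where o: "perm_dual ?X ((0, 0, \<tau>'), 0 + 0 + \<tau>' + 2, op2 a b c p q r)"
      and e: "anomaly_free2 0 0 \<tau>' a b c p q r"
      unfolding reaches2_def by blast
    have "?TwoZeros \<tau>' (op2 a b c p q r)"
      using op2_bracket_form_two_zeros[OF e]
      by (intro exI[of _ 1] exI[of _ p] exI[of _ q] exI[of _ "- r"]) simp
    with o show ?thesis by blast
  next
    case (nonzero \<kappa>' \<gamma>' \<tau>')
    then obtain a b c p q r where
      o: "perm_dual ?X ((\<kappa>', \<gamma>', \<tau>'), \<kappa>' + \<gamma>' + \<tau>' + 2, op2 a b c p q r)"
      and e: "anomaly_free2 \<kappa>' \<gamma>' \<tau>' a b c p q r"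
      unfolding reaches2_def by blast
    have "?Brackets \<kappa>' \<gamma>' \<tau>' (op2 a b c p q r)"
      using op2_bracket_form[OF e nonzero(2-4)]
      by (intro exI[of _ 1] exI[of _ "- b / (\<kappa>' * \<tau>')"] exI[of _ "- c / (\<kappa>' * \<gamma>')"]) simp
    with o nonzero(2) show ?thesis by blast
  qed
qed

end
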